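(* Let $f$ be a $\mathcal U$ chain transitive relation on a uniform space $(X,\mathcal U)$. (a) The following conditions are equivalent. (i) The relation $f$ is $\mathcal U$ chain mixing. (ii) The relation $f\times f$ on $(X\times X,\mathcal U\times\mathcal U)$ is chain mixing (with respect to $\mathcal U\times\mathcal U$). (iii) The relation $f\times f$ on $(X\times X,\mathcal U\times\mathcal U)$ is chain transitive (with respect to $\mathcal U\times\mathcal U$). (iv) There does not exist for any integer $k>1$ a uniformly continuous surjection from $X$ to $\mathbb Z_k$ which maps $f$ to $s$. (b) If $f$ is $\mathcal U$ chain mixing then $f^{-1}$ is $\mathcal U$ chain mixing. (c) If for every positive integer $k$ the relation $f^k$ is $\mathcal U$ chain transitive, then $f$ is $\mathcal U$ chain mixing. Conversely, if $f$ is a uniformly continuous mapping which is $\mathcal U$ chain mixing, then for every positive integer $k$ the mapping $f^k$ is $\mathcal U$ chain mixing.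
   Context: $X$ is nonempty. A relation on $X$ is a subset of $X\times X$; $f^{-1}=\{(y,x):(x,y)\in f\}$; $f^k$ is the $k$-fold composition; $f$ is surjective if for every $x$ there are $y,z$ with $(x,y),(z,x)\in f$. $f\times f=\{((x_1,x_2),(y_1,y_2)):(x_1,y_1),(x_2,y_2)\in f\}$. The gage $\Gamma(\mathcal U)$ is the set of all bounded pseudo-metrics $d$ with $\{d<\epsilon\}\in\mathcal U$ for all $\epsilon>0$. For a sequence $(a_1,b_1),\dots,(a_n,b_n)\in f$, its $xy$ chain-bound with respect to $d$ is $\max(d(x,a_1),d(b_1,a_2),\dots,d(b_{n-1},a_n),d(b_n,y))$. $\mathcal C_{\mathcal U}f$ is the set of $(x,y)$ such that for every $d\in\Gamma(\mathcal U)$ and $\epsilon>0$ there is a sequence of some length $n\ge1$ in $f$ with $xy$ chain-bound with respect to $d$ less than $\epsilon$. $f$ is $\mathcal U$ chain transitive if it is surjective and $\mathcal C_{\mathcal U}f=X\times X$. $f$ is $\mathcal U$ chain mixing if it is surjective and for every $d\in\Gamma(\mathcal U)$, $\epsilon>0$, $x,y\in X$ there is a positive integer $N$ such that for all $n\ge N$ there is a sequence $(a_1,b_1),\dots,(a_n,b_n)\in f$ of length $n$ with $a_1=x$ and with $xy$ chain-bound with respect to $d$ less than $\epsilon$. $\mathbb Z_k=\mathbb Z/k\mathbb Z$ (with the discrete uniformity) and $s:\mathbb Z_k\to\mathbb Z_k$ is $s(n)=n+1$. A map $h$ maps $f$ to $s$ if $(x,y)\in f$ implies $h(y)=s(h(x))$.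 *)

theory Defs
  imports "HOL-Analysis.Analysis" "HOL-Number_Theory.Residues"
    "HOL-Probability.Discrete_Topology"
begin

text \<open>
  The uniform space is a type of class \<^class>\<open>uniform_space\<close> (no separation axiom is assumed).
  An entourage is a set whose membership predicate holds eventually in the filter
  \<^const>\<open>uniformity\<close>. The library's instance for pairs is the product uniformity.
\<close>

definition pseudometric :: "('a \<Rightarrow> 'a \<Rightarrow> real) \<Rightarrow> bool" where
  "pseudometric d \<longleftrightarrow>
     (\<forall>x y. 0 \<le> d x y) \<and> (\<forall>x. d x x = 0) \<and> (\<forall>x y. d x y = d y x) \<and>
     (\<forall>x y z. d x z \<le> d x y + d y z)"

definition gage :: "('a::uniform_space \<Rightarrow> 'a \<Rightarrow> real) set" where
  "gage = {d. pseudometric d \<and> (\<exists>B. \<forall>x y. d x y \<le> B) \<and>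
              (\<forall>\<epsilon>>0. eventually (\<lambda>(x, y). d x y < \<epsilon>) uniformity)}"

definition surj_rel :: "('a \<times> 'a) set \<Rightarrow> bool" where
  "surj_rel f \<longleftrightarrow> (\<forall>x. \<exists>y z. (x, y) \<in> f \<and> (z, x) \<in> f)"

definition rel_times :: "('a \<times> 'a) set \<Rightarrow> ('b \<times> 'b) set \<Rightarrow> (('a \<times> 'b) \<times> ('a \<times> 'b)) set" where
  "rel_times f g = {((x1, x2), (y1, y2)) | x1 x2 y1 y2. (x1, y1) \<in> f \<and> (x2, y2) \<in> g}"

text \<open>
  For \<open>ps = [(a\<^sub>1, b\<^sub>1), \<dots>, (a\<^sub>n, b\<^sub>n)]\<close> the lists \<open>x, b\<^sub>1, \<dots>, b\<^sub>n\<close> and \<open>a\<^sub>1, \<dots>, a\<^sub>n, y\<close> are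
  compared entry by entry, giving \<open>d x a\<^sub>1, d b\<^sub>1 a\<^sub>2, \<dots>, d b\<^sub>n y\<close>.
\<close>

definition chain_bound :: "('a \<Rightarrow> 'a \<Rightarrow> real) \<Rightarrow> 'a \<Rightarrow> 'a \<Rightarrow> ('a \<times> 'a) list \<Rightarrow> real" where
  "chain_bound d x y ps = Max (set (map2 d (x # map snd ps) (map fst ps @ [y])))"

definition chain_rel :: "('a::uniform_space \<times> 'a) set \<Rightarrow> ('a \<times> 'a) set" where
  "chain_rel f = {(x, y). \<forall>d\<in>gage. \<forall>\<epsilon>>0.
     \<exists>ps. length ps \<ge> 1 \<and> set ps \<subseteq> f \<and> chain_bound d x y ps < \<epsilon>}"

definition chain_transitive :: "('a::uniform_space \<times> 'a) set \<Rightarrow> bool" where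
  "chain_transitive f \<longleftrightarrow> surj_rel f \<and> chain_rel f = UNIV"

definition chain_mixing :: "('a::uniform_space \<times> 'a) set \<Rightarrow> bool" where
  "chain_mixing f \<longleftrightarrow> surj_rel f \<and>
     (\<forall>d\<in>gage. \<forall>\<epsilon>>0. \<forall>x y. \<exists>N\<ge>1. \<forall>n\<ge>N.
        \<exists>ps. length ps = n \<and> set ps \<subseteq> f \<and> fst (hd ps) = x \<and> chain_bound d x y ps < \<epsilon>)"

definition graph_of :: "('a \<Rightarrow> 'a) \<Rightarrow> ('a \<times> 'a) set" where
  "graph_of g = {(x, y). y = g x}"

text \<open>
  The cyclic group of order \<open>k\<close> is the library's \<^const>\<open>residue_ring\<close>, with carrier \<open>{0..k - 1}\<close>.
  Since \<^typ>\<open>int\<close> carries no uniformity in the library, the discrete uniformity is obtained by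
  composing with \<^const>\<open>discrete\<close>, the bijection onto \<^typ>\<open>int discrete\<close> (distances 0 and 1);
  the subspace uniformity on the carrier is again the discrete one.
\<close>

definition uniformly_continuous_discrete :: "('a::uniform_space \<Rightarrow> 'b) \<Rightarrow> bool" where
  "uniformly_continuous_discrete h \<longleftrightarrow> uniformly_continuous_on UNIV (\<lambda>x. discrete (h x))"

definition shift :: "int \<Rightarrow> int \<Rightarrow> int" where
  "shift k n = n \<oplus>\<^bsub>residue_ring k\<^esub> \<one>\<^bsub>residue_ring k\<^esub>"

definition maps_rel :: "('a \<Rightarrow> 'b) \<Rightarrow> ('a \<times> 'a) set \<Rightarrow> ('b \<Rightarrow> 'b) \<Rightarrow> bool" where
  "maps_rel h f s \<longleftrightarrow> (\<forall>x y. (x, y) \<in> f \<longrightarrow> h y = s (h x))"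

end

theory Submission
  imports Defs
begin

text \<open>
  Writing \<open>S = f O {d < \<epsilon>}\<close>, chains of length \<open>n\<close> that start exactly at \<open>x\<close> and have chain-bound
  below \<open>\<epsilon>\<close> are walks of length \<open>n\<close> of the relation \<open>S\<close>. Chain transitivity makes every such \<open>S\<close>
  strongly connected, and mixing says that all of them are aperiodic. If some \<open>S\<close> has period
  \<open>k > 1\<close>, the length modulo \<open>k\<close> of walks from a base point is the required map to \<open>\<int>\<^sub>k\<close>. Conversely, a
  uniformly continuous map \<open>h\<close> to \<open>\<int>\<^sub>k\<close> yields the pseudometric \<open>[h x \<noteq> h y]\<close>, whose chains
  of bound below 1 advance \<open>h\<close> by exactly their length.
\<close>

section \<open>Strongly connected relations and their period\<close>

lemma relpow_closed_walk_mult: "(z, z) \<in> R ^^ l \<Longrightarrow> (z, z) \<in> R ^^ (q * l)"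
proof (induction q)
  case (Suc q)
  show ?case using relpow_trans[OF Suc.prems Suc.IH[OF Suc.prems]] by simp
qed simp

text \<open>The lengths \<open>n\<close> and \<open>Suc n\<close> are coprime, so sums of the two
  cover all large lengths of closed walks at \<open>z\<close>; connectivity then carries this to any
  pair of endpoints.\<close>

lemma relpow_eventually:
  fixes R :: "('a \<times> 'a) set"
  assumes conn: "\<And>x y. \<exists>n. (x, y) \<in> R ^^ n"
    and c: "(z, z) \<in> R ^^ n" "(z, z) \<in> R ^^ Suc n"
  shows "\<exists>N. \<forall>m\<ge>N. (x, y) \<in> R ^^ m"
proof -
  have big: "(z, z) \<in> R ^^ m" if m: "m \<ge> n * n" for m
  proof (cases "n = 0")
    case True
    then show ?thesis using relpow_closed_walk_mult[OF c(2), of m] by simp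
  next
    case False
    \<comment> \<open>Since \<open>r < n \<le> q\<close>, exchanging \<open>r\<close> of the
      \<open>q\<close> loops of length \<open>n\<close> for loops of length \<open>Suc n\<close>
      absorbs the remainder.\<close>
    define q r where "q = m div n" and "r = m mod n"
    have "n \<le> q" using m False by (simp add: q_def less_eq_div_iff_mult_less_eq)
    moreover have "r < n" using False by (simp add: r_def)
    ultimately have "r \<le> q" by simp
    then obtain t where t: "q = r + t" using le_Suc_ex by blast
    have "m = q * n + r" by (simp add: q_def r_def)
    then have "m = t * n + r * Suc n" by (simp add: t algebra_simps)
    then show ?thesis
      using relpow_trans[OF relpow_closed_walk_mult[OF c(1), of t] relpow_closed_walk_mult[OF c(2), of r]] by simp
  qed
  obtain a b where a: "(x, z) \<in> R ^^ a" and b: "(z, y) \<in> R ^^ b" using conn by blast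
  have "(x, y) \<in> R ^^ m" if "m \<ge> a + n * n + b" for m
  proof -
    have "m - a - b \<ge> n * n" using that by linarith
    then have "(x, y) \<in> R ^^ (a + (m - a - b) + b)"
      using relpow_trans[OF relpow_trans[OF a big] b] by blast
    moreover have "a + (m - a - b) + b = m" using that by linarith
    ultimately show ?thesis by (simp only:)
  qed
  then show ?thesis by blast
qed

text \<open>
  The modulus \<open>k\<close> is the least positive difference of lengths of closed walks at a point;
  such a difference divides the length of every closed walk at that point.
\<close>

lemma relpow_dichotomy:
  fixes R :: "('a \<times> 'a) set"
  assumes conn: "\<And>x y. \<exists>n\<ge>1. (x, y) \<in> R ^^ n"
  obtains (aperiodic) "\<And>x y. \<exists>N. \<forall>m\<ge>N. (x, y) \<in> R ^^ m"
    | (periodic) k :: nat where "k > 1"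
      "\<And>x y m n. (x, y) \<in> R ^^ m \<Longrightarrow> (x, y) \<in> R ^^ n \<Longrightarrow> m mod k = n mod k"
proof -
  fix z :: 'a
  define D where "D j \<longleftrightarrow> j > 0 \<and> (\<exists>n. (z, z) \<in> R ^^ n \<and> (z, z) \<in> R ^^ (n + j))" for j
  define k where "k = (LEAST j. D j)"
  obtain n0 where "n0 \<ge> 1" "(z, z) \<in> R ^^ n0" using conn by blast
  \<comment> \<open>The walk of length 0 is closed, so the length of any closed walk is itself a
    difference of two such lengths.\<close>
  then have "D n0" unfolding D_def by (auto intro!: exI[of _ 0])
  then have "D k" unfolding k_def by (rule LeastI)
  then obtain n where k: "k > 0" and n: "(z, z) \<in> R ^^ n" "(z, z) \<in> R ^^ (n + k)"
    unfolding D_def by blast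
  have dvd: "k dvd a" if a: "(z, z) \<in> R ^^ a" for a
  proof (rule ccontr)
    assume "\<not> k dvd a"
    then have r: "a mod k > 0" by (simp add: mod_greater_zero_iff_not_dvd)
    \<comment> \<open>Adding \<open>q\<close> loops of length \<open>n\<close> to the given walk,
      and comparing with \<open>q\<close> loops of length \<open>n + k\<close>, leaves the
      difference \<open>a mod k\<close>, which is below the minimum \<open>k\<close>.\<close>
    define q where "q = a div k"
    have "(z, z) \<in> R ^^ (a + q * n)" by (rule relpow_trans[OF a relpow_closed_walk_mult[OF n(1)]])
    moreover have "a + q * n = q * (n + k) + a mod k"
      by (simp add: q_def algebra_simps)
    ultimately have "D (a mod k)" unfolding D_def using r relpow_closed_walk_mult[OF n(2), of q] by auto
    then have "k \<le> a mod k" unfolding k_def by (rule Least_le)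
    then show False using k by (meson mod_less_divisor not_less)
  qed
  show thesis
  proof (cases "k = 1")
    case True
    show thesis
    proof (rule aperiodic)
      show "\<exists>N. \<forall>m\<ge>N. (x, y) \<in> R ^^ m" for x y
        by (rule relpow_eventually[of R z n]) (use conn n True in \<open>auto\<close>)
    qed
  next
    case False
    show thesis
    proof (rule periodic)
      show "k > 1" using False k by simp
      fix x y m l assume m: "(x, y) \<in> R ^^ m" and l: "(x, y) \<in> R ^^ l"
      \<comment> \<open>Both walks are closed up at \<open>z\<close> by the same two connecting
        walks, whose lengths cancel modulo \<open>k\<close>.\<close>
      obtain a b where a: "(z, x) \<in> R ^^ a" and b: "(y, z) \<in> R ^^ b" using conn by blast
      have "k dvd a + m + b" "k dvd a + l + b"
        using dvd relpow_trans[OF relpow_trans[OF a m] b]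
          relpow_trans[OF relpow_trans[OF a l] b] by blast+
      then have "[a + m + b = a + l + b] (mod k)"
        by (simp only: Cong.cong_def dvd_eq_mod_eq_0)
      then show "m mod k = l mod k"
        by (simp add: cong_add_rcancel_nat cong_add_lcancel_nat flip: Cong.cong_def)
    qed
  qed
qed

lemma relpow_mono_rel: "R \<subseteq> S \<Longrightarrow> R ^^ n \<subseteq> S ^^ n" for R S :: "('a \<times> 'a) set"
  by (induction n) (auto intro: relcomp_mono)

lemma converse_relpow: "(R ^^ n)\<inverse> = R\<inverse> ^^ n" for R :: "('a \<times> 'a) set"
  by (induction n) (simp_all add: converse_relcomp relpow_commute)

lemma relpow_mult: "R ^^ (m * n) = (R ^^ m) ^^ n" for R :: "('a \<times> 'a) set"
  by (induction n) (simp_all add: relpow_add relpow_commute)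

lemma relpow_cong_int:
  fixes h :: "'a \<Rightarrow> int"
  assumes "\<And>x y. (x, y) \<in> R \<Longrightarrow> [h y = h x + c] (mod k)" "(x, y) \<in> R ^^ n"
  shows "[h y = h x + int n * c] (mod k)"
  using assms(2)
proof (induction n arbitrary: y)
  case (Suc n)
  then obtain w where "(x, w) \<in> R ^^ n" "(w, y) \<in> R" by auto
  then have "[h y = h w + c] (mod k)" "[h w + c = h x + int n * c + c] (mod k)"
    using Suc.IH assms(1) by (auto intro: cong_add)
  then show ?case by (metis cong_trans add.assoc distrib_right mult_1 of_nat_Suc add.commute)
qed simp

lemma rel_times_iff: "((x, x'), (y, y')) \<in> rel_times f g \<longleftrightarrow> (x, y) \<in> f \<and> (x', y') \<in> g"
  by (simp add: rel_times_def)

lemma relpow_rel_times: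
  "((x, x'), (y, y')) \<in> rel_times R S ^^ n \<longleftrightarrow> (x, y) \<in> R ^^ n \<and> (x', y') \<in> S ^^ n"
proof (induction n arbitrary: y y')
  case (Suc n)
  then show ?case by (simp add: relcomp_unfold rel_times_iff) blast
qed auto

section \<open>Chains as powers of a relation\<close>

definition step :: "('a \<times> 'a) set \<Rightarrow> ('a \<Rightarrow> 'a \<Rightarrow> real) \<Rightarrow> real \<Rightarrow> ('a \<times> 'a) set" where
  "step f d e = f O {(x, y). d x y < e}"

lemma stepI: "(x, b) \<in> f \<Longrightarrow> d b y < e \<Longrightarrow> (x, y) \<in> step f d e"
  by (auto simp: step_def)

lemma stepE:
  assumes "(x, y) \<in> step f d e"
  obtains b where "(x, b) \<in> f" "d b y < e"
  using assms by (auto simp: step_def)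

lemma step_mono: "e \<le> e' \<Longrightarrow> step f d e \<subseteq> step f d e'"
  by (force simp: step_def)

lemma chain_bound_Nil: "chain_bound d x y [] = d x y"
  by (simp add: chain_bound_def)

lemma chain_bound_Cons:
  "chain_bound d x y (p # ps) = max (d x (fst p)) (chain_bound d (snd p) y ps)"
proof -
  let ?l = "map2 d (snd p # map snd ps) (map fst ps @ [y])"
  have "?l \<noteq> []" by (cases ps) auto
  moreover have "map2 d (x # map snd (p # ps)) (map fst (p # ps) @ [y]) = d x (fst p) # ?l" by simp
  ultimately show ?thesis
    unfolding chain_bound_def by (simp only: list.set Max_insert List.finite_set set_empty simp_thms)
qed

text \<open>An unrestricted chain also has a jump before its first pair, hence the extra factor in
  front of the power. The empty list has bound \<open>d x y\<close>, which lets the induction start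
  at 0.\<close>

lemma chain_iff_relpow:
  "(\<exists>ps. length ps = n \<and> set ps \<subseteq> f \<and> chain_bound d x y ps < e) \<longleftrightarrow>
    (x, y) \<in> {(x, y). d x y < e} O step f d e ^^ n"
proof (induction n arbitrary: x)
  case 0
  then show ?case by (simp add: chain_bound_Nil)
next
  case (Suc n)
  let ?C = "\<lambda>x ps. set ps \<subseteq> f \<and> chain_bound d x y ps < e"
  let ?E = "{(x, y). d x y < e}"
  have "(\<exists>ps. length ps = Suc n \<and> ?C x ps) \<longleftrightarrow> (\<exists>p ps. length ps = n \<and> ?C x (p # ps))"
    by (auto simp only: length_Suc_conv)
  also have "\<dots> \<longleftrightarrow> (\<exists>a b. d x a < e \<and> (a, b) \<in> f \<and> (\<exists>ps. length ps = n \<and> ?C b ps))"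
    by (simp add: chain_bound_Cons) blast
  also have "\<dots> \<longleftrightarrow> (x, y) \<in> ?E O ((f O ?E) O step f d e ^^ n)"
    unfolding Suc.IH by blast
  finally show ?case by (simp only: step_def relpow_commute relpow.simps)
qed

text \<open>Requiring the first pair to start at \<open>x\<close> makes the initial jump trivial, so
  the extra factor disappears. The length is \<open>Suc n\<close> because \<open>hd\<close> of the
  empty list is unspecified.\<close>

lemma chain_from_iff_relpow:
  assumes "d x x < e"
  shows "(\<exists>ps. length ps = Suc n \<and> set ps \<subseteq> f \<and> fst (hd ps) = x \<and> chain_bound d x y ps < e) \<longleftrightarrow>
    (x, y) \<in> step f d e ^^ Suc n"
proof -
  let ?C = "\<lambda>x ps. set ps \<subseteq> f \<and> chain_bound d x y ps < e"
  let ?E = "{(x, y). d x y < e}"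
  have "(\<exists>ps. length ps = Suc n \<and> set ps \<subseteq> f \<and> fst (hd ps) = x \<and> chain_bound d x y ps < e) \<longleftrightarrow>
      (\<exists>p ps. length ps = n \<and> fst p = x \<and> ?C x (p # ps))"
  proof
    assume "\<exists>ps. length ps = Suc n \<and> set ps \<subseteq> f \<and> fst (hd ps) = x \<and> chain_bound d x y ps < e"
    then show "\<exists>p ps. length ps = n \<and> fst p = x \<and> ?C x (p # ps)"
      by (metis length_Suc_conv list.sel(1))
  next
    assume "\<exists>p ps. length ps = n \<and> fst p = x \<and> ?C x (p # ps)"
    then show "\<exists>ps. length ps = Suc n \<and> set ps \<subseteq> f \<and> fst (hd ps) = x \<and> chain_bound d x y ps < e"
      by (metis length_Cons list.sel(1))
  qed
  also have "\<dots> \<longleftrightarrow> (\<exists>b. (x, b) \<in> f \<and> (\<exists>ps. length ps = n \<and> ?C b ps))"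
    using assms by (simp add: chain_bound_Cons) blast
  also have "\<dots> \<longleftrightarrow> (x, y) \<in> (f O ?E) O step f d e ^^ n"
    unfolding chain_iff_relpow by blast
  finally show ?thesis by (simp only: step_def relpow_commute relpow.simps)
qed

lemma gage_pseudometric:
  assumes "d \<in> gage"
  shows "0 \<le> d x y" "d x x = 0" "d x y = d y x" "d x z \<le> d x y + d y z"
  using assms by (auto simp: gage_def pseudometric_def)

lemma gage_eventually:
  "d \<in> gage \<Longrightarrow> e > 0 \<Longrightarrow> eventually (\<lambda>(x, y). d x y < e) uniformity"
  unfolding gage_def by blast

lemma gage_bounded: "d \<in> gage \<Longrightarrow> \<exists>B. \<forall>x y. d x y \<le> B"
  by (auto simp: gage_def)

lemma gageI:
  assumes "\<And>x y. 0 \<le> d x y" "\<And>x. d x x = 0" "\<And>x y. d x y = d y x"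
    "\<And>x y z. d x z \<le> d x y + d y z" "\<And>x y. d x y \<le> B"
    "\<And>e. e > 0 \<Longrightarrow> eventually (\<lambda>p. d (fst p) (snd p) < e) uniformity"
  shows "d \<in> gage"
  unfolding gage_def pseudometric_def case_prod_beta'
  by (intro CollectI conjI allI impI exI[of _ B]) (fact assms | erule assms)+

lemma subset_step: "d \<in> gage \<Longrightarrow> e > 0 \<Longrightarrow> f \<subseteq> step f d e"
  by (auto intro!: stepI simp: gage_pseudometric)

lemma chain_mixing_iff:
  "chain_mixing f \<longleftrightarrow> surj_rel f \<and>
    (\<forall>d\<in>gage. \<forall>e>0. \<forall>x y. \<exists>N. \<forall>n\<ge>N. (x, y) \<in> step f d e ^^ n)"
proof -
  \<comment> \<open>Chains and walks correspond only in positive lengths, which suffices for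
    statements about all large lengths.\<close>
  have eventually_iff: "(\<exists>N\<ge>1. \<forall>n\<ge>N. P n) \<longleftrightarrow> (\<exists>N. \<forall>n\<ge>N. Q n)"
    if "\<And>n. n \<ge> 1 \<Longrightarrow> P n \<longleftrightarrow> Q n" for P Q :: "nat \<Rightarrow> bool"
  proof
    assume "\<exists>N\<ge>1. \<forall>n\<ge>N. P n"
    then show "\<exists>N. \<forall>n\<ge>N. Q n" using that by (meson order_trans)
  next
    assume "\<exists>N. \<forall>n\<ge>N. Q n"
    then obtain N where "\<forall>n\<ge>N. Q n" by blast
    then show "\<exists>N\<ge>1. \<forall>n\<ge>N. P n" using that by (intro exI[of _ "max 1 N"]) auto
  qed
  have "(\<exists>N\<ge>1. \<forall>n\<ge>N. \<exists>ps. length ps = n \<and> set ps \<subseteq> f \<and> fst (hd ps) = x \<and> chain_bound d x y ps < e)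
      \<longleftrightarrow> (\<exists>N. \<forall>n\<ge>N. (x, y) \<in> step f d e ^^ n)"
    if "d \<in> gage" "e > 0" for d e x y
  proof (rule eventually_iff)
    fix n :: nat assume "n \<ge> 1"
    then show "(\<exists>ps. length ps = n \<and> set ps \<subseteq> f \<and> fst (hd ps) = x \<and> chain_bound d x y ps < e)
        \<longleftrightarrow> (x, y) \<in> step f d e ^^ n"
      using chain_from_iff_relpow[of d x e "n - 1" f y] \<open>e > 0\<close> gage_pseudometric(2)[OF \<open>d \<in> gage\<close>]
      by simp
  qed
  then show ?thesis
    unfolding chain_mixing_def by (intro conj_cong ball_cong all_cong1 imp_cong refl)
qed

lemma chain_transitive_iff:
  fixes f :: "('a::uniform_space \<times> 'a) set"
  shows "chain_transitive f \<longleftrightarrow> surj_rel f \<and>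
    (\<forall>d\<in>gage. \<forall>e>0. \<forall>x y. \<exists>n\<ge>1. (x, y) \<in> step f d e ^^ n)"
proof -
  let ?E = "\<lambda>d e. {(x, y). d x y < e}"
  have swap: "{(x, y). \<forall>d\<in>gage. \<forall>e>0. P d e x y} = UNIV \<longleftrightarrow> (\<forall>d\<in>gage. \<forall>e>0. \<forall>x y. P d e x y)"
    for P :: "('a \<Rightarrow> 'a \<Rightarrow> real) \<Rightarrow> real \<Rightarrow> 'a \<Rightarrow> 'a \<Rightarrow> bool"
  proof -
    have "{(x, y). Q x y} = UNIV \<longleftrightarrow> (\<forall>x y. Q x y)" for Q :: "'a \<Rightarrow> 'a \<Rightarrow> bool"
      by auto
    then show ?thesis by blast
  qed
  have by_length: "(\<exists>ps. length ps \<ge> 1 \<and> Q ps) \<longleftrightarrow> (\<exists>n\<ge>1. \<exists>ps. length ps = n \<and> Q ps)"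
    for Q :: "('a \<times> 'a) list \<Rightarrow> bool"
    by blast
  have *: "chain_rel f = UNIV \<longleftrightarrow>
      (\<forall>d\<in>gage. \<forall>e>0. \<forall>x y. \<exists>n\<ge>1. (x, y) \<in> ?E d e O step f d e ^^ n)"
    unfolding chain_rel_def by_length chain_iff_relpow by (rule swap)
  have "(\<forall>x y. \<exists>n\<ge>1. (x, y) \<in> ?E d e O step f d e ^^ n) \<longleftrightarrow>
      (\<forall>x y. \<exists>n\<ge>1. (x, y) \<in> step f d e ^^ n)" (is "?L \<longleftrightarrow> ?R")
    if surj: "surj_rel f" and d: "d \<in> gage" and e: "e > 0" for d e
  proof
    assume L: ?L
    show ?R
    proof (intro allI)
      fix x y
      \<comment> \<open>The initial jump is absorbed by starting with an exact edge from
        \<open>x\<close> to \<open>b\<close>: the first jump of a chain from \<open>b\<close>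
        becomes the jump after this edge.\<close>
      obtain b where b: "(x, b) \<in> f" using surj unfolding surj_rel_def by blast
      obtain n where "(b, y) \<in> ?E d e O step f d e ^^ n" using L by blast
      then obtain c where c: "d b c < e" "(c, y) \<in> step f d e ^^ n" by auto
      have "(x, y) \<in> step f d e ^^ Suc n" using relpow_Suc_I2[OF _ c(2)] stepI[of x b f d c e] b c(1) by blast
      then show "\<exists>n\<ge>1. (x, y) \<in> step f d e ^^ n" by (intro exI[of _ "Suc n"] conjI) simp_all
    qed
  next
    assume R: ?R
    show ?L
    proof (intro allI)
      fix x y
      obtain n where "n \<ge> 1" "(x, y) \<in> step f d e ^^ n" using R by blast
      moreover have "(x, x) \<in> ?E d e" using e gage_pseudometric(2)[OF d] by simp
      ultimately show "\<exists>n\<ge>1. (x, y) \<in> ?E d e O step f d e ^^ n" by blast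
    qed
  qed
  note step_iff = this
  show ?thesis
    unfolding chain_transitive_def *
    by (intro conj_cong ball_cong refl) (rule all_cong1, rule imp_cong[OF refl], rule step_iff)
qed

lemma chain_mixingD:
  assumes "chain_mixing f" "d \<in> gage" "e > 0"
  shows "\<exists>N. \<forall>n\<ge>N. (x, y) \<in> step f d e ^^ n"
  using assms unfolding chain_mixing_iff by blast

lemma chain_transitiveD:
  assumes "chain_transitive f" "d \<in> gage" "e > 0"
  shows "\<exists>n\<ge>1. (x, y) \<in> step f d e ^^ n"
  using assms unfolding chain_transitive_iff by blast

section \<open>Products\<close>

text \<open>With this pseudometric, one chain of the product relation splits into two chains of the
  same length with the same bound.\<close>

lemma gage_max:
  assumes "d \<in> gage"
  shows "(\<lambda>p q. max (d (fst p) (fst q)) (d (snd p) (snd q))) \<in> gage"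
proof -
  obtain B where B: "\<And>x y. d x y \<le> B" using gage_bounded[OF assms] by blast
  note g = gage_pseudometric[OF assms]
  show ?thesis
  proof (rule gageI[where B = B])
    fix e :: real assume "e > 0"
    then have "eventually (\<lambda>(x, y). d x y < e) uniformity" using assms gage_eventually by blast
    then have "\<forall>\<^sub>F (p, q) in uniformity \<times>\<^sub>F uniformity. d (fst p) (snd p) < e \<and> d (fst q) (snd q) < e"
      by (auto simp: eventually_prod_same)
    then show "\<forall>\<^sub>F p in uniformity. max (d (fst (fst p)) (fst (snd p))) (d (snd (fst p)) (snd (snd p))) < e"
      by (simp add: uniformity_prod_def eventually_filtermap case_prod_beta')
  next
    fix x y z :: "'a \<times> 'a"
    show "max (d (fst x) (fst z)) (d (snd x) (snd z))
        \<le> max (d (fst x) (fst y)) (d (snd x) (snd y)) + max (d (fst y) (fst z)) (d (snd y) (snd z))"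
      using g(4)[of "fst x" "fst z" "fst y"] g(4)[of "snd x" "snd z" "snd y"] by linarith
  qed (use g B in \<open>auto simp: le_max_iff_disj\<close>)
qed

text \<open>
  The pseudometrics \<open>d1\<close> and \<open>d2\<close> are suprema of \<open>d\<close> over the other coordinate, which avoids the
  theorem that the gage generates the uniformity.
\<close>

lemma gage_prod_bound:
  fixes d :: "'a::uniform_space \<times> 'b::uniform_space \<Rightarrow> _"
  assumes "d \<in> gage"
  obtains d1 d2 where "d1 \<in> gage" "d2 \<in> gage"
    "\<And>x y x' y'. d (x, y) (x', y') \<le> d1 x x' + d2 y y'"
proof -
  obtain B where B: "\<And>x y. d x y \<le> B" using gage_bounded[OF assms] by blast
  note g = gage_pseudometric[OF assms]
  have small: "\<exists>P Q. eventually P uniformity \<and> eventually Q uniformity \<and>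
      (\<forall>x x' y y'. P (x, x') \<longrightarrow> Q (y, y') \<longrightarrow> d (x, y) (x', y') < e)" if e: "e > 0" for e
  proof -
    obtain P Q where "eventually P uniformity" "eventually Q uniformity"
      and "\<forall>p q. P p \<longrightarrow> Q q \<longrightarrow> d (fst p, fst q) (snd p, snd q) < e"
      using gage_eventually[OF assms e]
      by (auto simp: uniformity_prod_def eventually_filtermap eventually_prod_filter case_prod_beta')
    then show ?thesis by (metis fst_conv snd_conv)
  qed
  \<comment> \<open>A supremum stays in the gage because one entourage makes all members of the
    family small at once. For \<open>d1\<close> and \<open>d2\<close> this follows from a rectangle
    in the product uniformity, the fixed coordinate giving a diagonal pair.\<close>
  have sup: "(\<lambda>x x'. SUP t. D t x x') \<in> gage"
    if D: "\<And>t x y. 0 \<le> D t x y" "\<And>t x. D t x x = 0" "\<And>t x y. D t x y = D t y x"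
      "\<And>t x y z. D t x z \<le> D t x y + D t y z" "\<And>t x y. D t x y \<le> B"
      and small: "\<And>e. e > 0 \<Longrightarrow>
        \<exists>P. eventually P uniformity \<and> (\<forall>t x y. P (x, y) \<longrightarrow> D t x y < e)"
    for D :: "'t \<Rightarrow> 'c::uniform_space \<Rightarrow> 'c \<Rightarrow> real"
  proof -
    have bdd: "bdd_above (range (\<lambda>t. D t x y))" for x y by (rule bdd_aboveI2) (rule D(5))
    show ?thesis
    proof (rule gageI[where B = B])
      show "0 \<le> (SUP t. D t x y)" for x y
        by (rule cSUP_upper2[OF bdd UNIV_I]) (use D in auto)
      show "(SUP t. D t x z) \<le> (SUP t. D t x y) + (SUP t. D t y z)" for x y z
      proof (rule cSUP_least)
        show "D t x z \<le> (SUP t. D t x y) + (SUP t. D t y z)" for t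
          using D(4)[of t x z y] cSUP_upper[OF UNIV_I bdd, of t x y]
            cSUP_upper[OF UNIV_I bdd, of t y z] by linarith
      qed simp
      show "(SUP t. D t x y) \<le> B" for x y by (rule cSUP_least) (use D in auto)
      fix e :: real assume "e > 0"
      then obtain P where P: "eventually P uniformity" "\<And>t x y. P (x, y) \<Longrightarrow> D t x y < e / 2"
        using small[of "e / 2"] by auto
      \<comment> \<open>A supremum of values below \<open>e / 2\<close> is only known to be at most
        \<open>e / 2\<close>; the halving restores strictness.\<close>
      have "(SUP t. D t x y) < e" if "P (x, y)" for x y
      proof -
        have "(SUP t. D t x y) \<le> e / 2" by (rule cSUP_least) (use P(2)[OF that] in \<open>auto intro: less_imp_le\<close>)
        then show ?thesis using \<open>e > 0\<close> by simp
      qed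
      with P(1) show "\<forall>\<^sub>F p in uniformity. (SUP t. D t (fst p) (snd p)) < e"
        by (auto elim!: eventually_mono)
    qed (use D in auto)
  qed
  define d1 d2 where "d1 = (\<lambda>x x'. SUP y. d (x, y) (x', y))"
    and "d2 = (\<lambda>y y'. SUP x. d (x, y) (x, y'))"
  show thesis
  proof
    show "d1 \<in> gage" unfolding d1_def
    proof (rule sup)
      fix e :: real assume "e > 0"
      then show "\<exists>P. eventually P uniformity \<and> (\<forall>t x y. P (x, y) \<longrightarrow> d (x, t) (y, t) < e)"
        using small uniformity_refl by metis
    qed (rule g B)+
    show "d2 \<in> gage" unfolding d2_def
    proof (rule sup)
      fix e :: real assume "e > 0"
      then show "\<exists>P. eventually P uniformity \<and> (\<forall>t x y. P (x, y) \<longrightarrow> d (t, x) (t, y) < e)"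
        using small uniformity_refl by metis
    qed (rule g B)+
    fix x y x' y'
    have "d (x, y) (x', y) \<le> d1 x x'" unfolding d1_def
      by (rule cSUP_upper[OF UNIV_I bdd_aboveI2[OF B]])
    moreover have "d (x', y) (x', y') \<le> d2 y y'" unfolding d2_def
      by (rule cSUP_upper[OF UNIV_I bdd_aboveI2[OF B]])
    ultimately show "d (x, y) (x', y') \<le> d1 x x' + d2 y y'"
      using g(4)[of "(x, y)" "(x', y')" "(x', y)"] by linarith
  qed
qed

lemma surj_rel_times:
  assumes "surj_rel f" "surj_rel g"
  shows "surj_rel (rel_times f g)"
  unfolding surj_rel_def
proof
  fix p :: "'a \<times> 'b"
  obtain y z where "(fst p, y) \<in> f" "(z, fst p) \<in> f" using assms(1) unfolding surj_rel_def by blast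
  moreover obtain y' z' where "(snd p, y') \<in> g" "(z', snd p) \<in> g"
    using assms(2) unfolding surj_rel_def by blast
  ultimately have "(p, (y, y')) \<in> rel_times f g \<and> ((z, z'), p) \<in> rel_times f g"
    using rel_times_iff by (metis prod.collapse)
  then show "\<exists>y z. (p, y) \<in> rel_times f g \<and> (z, p) \<in> rel_times f g" by blast
qed

text \<open>Walks run in parallel once their lengths agree, and mixing offers every length beyond
  both thresholds. Each coordinate gets half of the allowed jump.\<close>

lemma chain_mixing_times:
  assumes "chain_mixing f" "chain_mixing g"
  shows "chain_mixing (rel_times f g)"
  unfolding chain_mixing_iff
proof (intro conjI ballI allI impI)
  show "surj_rel (rel_times f g)" using assms surj_rel_times by (auto simp: chain_mixing_iff)
  fix d :: "'a \<times> 'b \<Rightarrow> 'a \<times> 'b \<Rightarrow> real" and e :: real and p q :: "'a \<times> 'b"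
  assume "d \<in> gage" and e: "e > 0"
  then obtain d1 d2 where d: "d1 \<in> gage" "d2 \<in> gage"
    "\<And>x y x' y'. d (x, y) (x', y') \<le> d1 x x' + d2 y y'" using gage_prod_bound by blast
  have sub: "rel_times (step f d1 (e / 2)) (step g d2 (e / 2)) \<subseteq> step (rel_times f g) d e"
  proof
    fix r assume "r \<in> rel_times (step f d1 (e / 2)) (step g d2 (e / 2))"
    then obtain x x' y y' where r: "r = ((x, x'), (y, y'))"
      and "(x, y) \<in> step f d1 (e / 2)" "(x', y') \<in> step g d2 (e / 2)"
      unfolding rel_times_def by blast
    then obtain b b' where b: "(x, b) \<in> f" "(x', b') \<in> g" "d1 b y < e / 2" "d2 b' y' < e / 2"
      by (meson stepE)
    have "d (b, b') (y, y') < e" using b d(3)[of b b' y y'] by linarith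
    moreover have "((x, x'), (b, b')) \<in> rel_times f g" using b by (auto simp: rel_times_def)
    ultimately show "r \<in> step (rel_times f g) d e" unfolding r by (rule stepI[rotated])
  qed
  obtain N1 where N1: "\<And>n. n \<ge> N1 \<Longrightarrow> (fst p, fst q) \<in> step f d1 (e / 2) ^^ n"
    using chain_mixingD[OF assms(1) d(1) half_gt_zero[OF e]] by metis
  obtain N2 where N2: "\<And>n. n \<ge> N2 \<Longrightarrow> (snd p, snd q) \<in> step g d2 (e / 2) ^^ n"
    using chain_mixingD[OF assms(2) d(2) half_gt_zero[OF e]] by metis
  have "(p, q) \<in> step (rel_times f g) d e ^^ n" if "n \<ge> max N1 N2" for n
  proof -
    have "((fst p, snd p), (fst q, snd q)) \<in> rel_times (step f d1 (e / 2)) (step g d2 (e / 2)) ^^ n"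
      unfolding relpow_rel_times using N1 N2 that by simp
    then show ?thesis using relpow_mono_rel[OF sub] by (simp only: prod.collapse subset_iff)
  qed
  then show "\<exists>N. \<forall>n\<ge>N. (p, q) \<in> step (rel_times f g) d e ^^ n" by blast
qed

lemma chain_mixing_imp_transitive:
  assumes "chain_mixing f"
  shows "chain_transitive f"
  unfolding chain_transitive_iff
proof (intro conjI ballI allI impI)
  show "surj_rel f" using assms by (simp add: chain_mixing_iff)
  fix d :: "'a \<Rightarrow> 'a \<Rightarrow> real" and e :: real and x y
  assume "d \<in> gage" "e > 0"
  then obtain N where "\<forall>n\<ge>N. (x, y) \<in> step f d e ^^ n" using chain_mixingD[OF assms] by blast
  then show "\<exists>n\<ge>1. (x, y) \<in> step f d e ^^ n" by (intro exI[of _ "max 1 N"]) simp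
qed

text \<open>
  A walk of \<open>f \<times> f\<close> from \<open>(x, x)\<close> to \<open>(x, b)\<close>, where \<open>b\<close> precedes \<open>x\<close>, yields closed walks at \<open>x\<close>
  of two consecutive lengths.
\<close>

lemma chain_transitive_times_imp_mixing:
  assumes "chain_transitive f" "chain_transitive (rel_times f f)"
  shows "chain_mixing f"
  unfolding chain_mixing_iff
proof (intro conjI ballI allI impI)
  show surj: "surj_rel f" using assms(1) by (simp add: chain_transitive_iff)
  fix d :: "'a \<Rightarrow> 'a \<Rightarrow> real" and e :: real and x y
  assume d: "d \<in> gage" and e: "e > 0"
  let ?dd = "\<lambda>p q. max (d (fst p) (fst q)) (d (snd p) (snd q))"
  let ?S = "step f d e"
  have sub: "step (rel_times f f) ?dd e \<subseteq> rel_times ?S ?S"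
  proof
    fix r assume r: "r \<in> step (rel_times f f) ?dd e"
    obtain x x' y y' where eq: "r = ((x, x'), (y, y'))" by (metis prod.collapse)
    obtain b where "((x, x'), b) \<in> rel_times f f" "?dd b (y, y') < e"
      using r unfolding eq by (rule stepE)
    then have "(x, fst b) \<in> f" "(x', snd b) \<in> f" "d (fst b) y < e" "d (snd b) y' < e"
      using rel_times_iff[of x x' "fst b" "snd b" f f] by simp_all
    then show "r \<in> rel_times ?S ?S" unfolding eq rel_times_iff by (blast intro: stepI)
  qed
  obtain b where b: "(b, x) \<in> f" using surj unfolding surj_rel_def by blast
  obtain n where "((x, x), (x, b)) \<in> step (rel_times f f) ?dd e ^^ n"
    using chain_transitiveD[OF assms(2) gage_max[OF d] e, of "(x, x)" "(x, b)"] by blast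
  then have "((x, x), (x, b)) \<in> rel_times ?S ?S ^^ n" by (rule subsetD[OF relpow_mono_rel[OF sub]])
  then have n: "(x, x) \<in> ?S ^^ n" "(x, b) \<in> ?S ^^ n" by (simp_all only: relpow_rel_times)
  have n': "(x, x) \<in> ?S ^^ Suc n"
    using n(2) subsetD[OF subset_step[OF d e] b] by (rule relpow_Suc_I)
  have conn: "\<exists>n. (x, y) \<in> ?S ^^ n" for x y
    using chain_transitiveD[OF assms(1) d e, of x y] by blast
  show "\<exists>N. \<forall>n\<ge>N. (x, y) \<in> ?S ^^ n"
    by (rule relpow_eventually[OF conn n(1) n'])
qed

section \<open>Cyclic factors\<close>

lemma maps_rel_shift_cong:
  "maps_rel h f (shift k) \<Longrightarrow> (x, y) \<in> f \<Longrightarrow> [h y = h x + 1] (mod k)"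
  by (auto simp: maps_rel_def shift_def residue_ring_def Cong.cong_def)

text \<open>The diagonal is an entourage of the discrete uniformity, so uniform continuity means
  that a single entourage keeps \<open>h\<close> constant.\<close>

lemma uniformly_continuous_discrete_iff:
  "uniformly_continuous_discrete h \<longleftrightarrow> eventually (\<lambda>(x, y). h x = h y) uniformity"
proof
  assume h: "uniformly_continuous_discrete h"
  have "eventually (\<lambda>(x, y). x = y) (uniformity :: ('b discrete \<times> 'b discrete) filter)"
    unfolding eventually_uniformity_metric by (intro exI[of _ 1]) (auto simp: dist_discrete_def)
  from uniformly_continuous_onD[OF h[unfolded uniformly_continuous_discrete_def] this]
  have "eventually (\<lambda>(x, y). discrete (h x) = discrete (h y)) uniformity" by simp
  then show "eventually (\<lambda>(x, y). h x = h y) uniformity" by (simp add: discrete_inject)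
next
  assume ev: "eventually (\<lambda>(x, y). h x = h y) uniformity"
  have "eventually (\<lambda>(x, y). E (discrete (h x), discrete (h y))) uniformity"
    if "eventually E uniformity" for E
    using ev by eventually_elim (use uniformity_refl[OF that] in auto)
  then show "uniformly_continuous_discrete h"
    by (simp add: uniformly_continuous_discrete_def uniformly_continuous_on_uniformity
        filterlim_iff case_prod_beta')
qed

lemma gage_discrete:
  assumes "uniformly_continuous_discrete h"
  shows "(\<lambda>x y. if h x = h y then 0 else 1) \<in> gage"
proof (rule gageI[where B = 1])
  fix e :: real assume "e > 0"
  show "\<forall>\<^sub>F p in uniformity. (if h (fst p) = h (snd p) then 0 else 1) < e"
    using assms unfolding uniformly_continuous_discrete_iff
    by eventually_elim (use \<open>e > 0\<close> in auto)
qed auto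

text \<open>A jump below 1 leaves \<open>h\<close> unchanged, so only the edges move it. The
  increment is \<open>c = 1\<close> for a relation mapped to the shift, and \<open>c = k\<close> for
  its \<open>k\<close>-th power.\<close>

lemma step_discrete_cong:
  fixes h :: "'a \<Rightarrow> int"
  assumes "\<And>x y. (x, y) \<in> f \<Longrightarrow> [h y = h x + c] (mod k)"
    "(x, y) \<in> step f (\<lambda>x y. if h x = h y then 0 else 1) 1 ^^ n"
  shows "[h y = h x + int n * c] (mod k)"
proof (rule relpow_cong_int[OF _ assms(2)])
  fix x y assume "(x, y) \<in> step f (\<lambda>x y. if h x = h y then 0 else 1) 1"
  then show "[h y = h x + c] (mod k)" by (auto elim!: stepE dest: assms(1) split: if_splits)
qed

definition has_cyclic_factor :: "('a::uniform_space \<times> 'a) set \<Rightarrow> int \<Rightarrow> bool" where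
  "has_cyclic_factor f k \<longleftrightarrow> (\<exists>h. uniformly_continuous_discrete h \<and>
    h ` UNIV = carrier (residue_ring k) \<and> maps_rel h f (shift k))"

text \<open>Mixing gives closed walks of two consecutive lengths, whereas a factor forces
  \<open>k\<close> to divide both.\<close>

lemma chain_mixing_imp_no_cyclic_factor:
  assumes "chain_mixing f" "k > 1"
  shows "\<not> has_cyclic_factor f k"
proof
  assume "has_cyclic_factor f k"
  then obtain h where h: "uniformly_continuous_discrete h" "maps_rel h f (shift k)"
    by (auto simp: has_cyclic_factor_def)
  let ?S = "step f (\<lambda>x y. if h x = h y then 0 else 1) 1"
  fix x
  obtain N where N: "\<And>n. n \<ge> N \<Longrightarrow> (x, x) \<in> ?S ^^ n"
    using chain_mixingD[OF assms(1) gage_discrete[OF h(1)] zero_less_one] by metis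
  have "k dvd int n" if "n \<ge> N" for n
    using step_discrete_cong[of f h 1 k, OF maps_rel_shift_cong[OF h(2)] N[OF that]]
    by (simp add: cong_iff_dvd_diff)
  from this[of N] this[of "Suc N"] have "k dvd int N" "k dvd int (Suc N)" by simp_all
  then have "k dvd int (Suc N) - int N" by (rule dvd_diff[rotated])
  then show False using \<open>k > 1\<close> by simp
qed

lemma no_cyclic_factor_imp_chain_mixing:
  fixes f :: "('a::uniform_space \<times> 'a) set"
  assumes trans: "chain_transitive f" and none: "\<And>k. k > 1 \<Longrightarrow> \<not> has_cyclic_factor f k"
  shows "chain_mixing f"
  unfolding chain_mixing_iff
proof (intro conjI ballI allI impI)
  show "surj_rel f" using trans by (simp add: chain_transitive_iff)
  fix d :: "'a \<Rightarrow> 'a \<Rightarrow> real" and e :: real and x y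
  assume d: "d \<in> gage" and e: "e > 0"
  have conn: "\<exists>n\<ge>1. (x, y) \<in> step f d e' ^^ n" if "e' > 0" for x y e'
    by (rule chain_transitiveD[OF trans d that])
  let ?S = "step f d e"
  show "\<exists>N. \<forall>n\<ge>N. (x, y) \<in> ?S ^^ n"
  proof (rule relpow_dichotomy[OF conn[OF e]])
    assume "\<And>x y. \<exists>N. \<forall>m\<ge>N. (x, y) \<in> ?S ^^ m"
    then show ?thesis by blast
  next
    fix k :: nat
    assume k: "k > 1" and period: "\<And>x y m n. (x, y) \<in> ?S ^^ m \<Longrightarrow> (x, y) \<in> ?S ^^ n \<Longrightarrow> m mod k = n mod k"
    fix c :: 'a
    \<comment> \<open>The choice of walk is immaterial: by \<open>period\<close>, all walks from
      \<open>c\<close> to \<open>x\<close> have the same length modulo \<open>k\<close>.\<close>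
    define h where "h x = int ((SOME n. (c, x) \<in> ?S ^^ n) mod k)" for x
    have h: "h x = int (n mod k)" if "(c, x) \<in> ?S ^^ n" for x n
      unfolding h_def using period[OF someI[of "\<lambda>n. (c, x) \<in> ?S ^^ n", OF that] that] by simp
    have "has_cyclic_factor f (int k)"
      unfolding has_cyclic_factor_def
    proof (intro exI conjI)
      show "uniformly_continuous_discrete h"
        unfolding uniformly_continuous_discrete_iff
      proof (rule eventually_mono)
        show "eventually (\<lambda>(x, y). d x y < e / 2) uniformity"
          using gage_eventually[OF d, of "e / 2"] e by simp
        \<comment> \<open>a walk ending at \<open>x\<close> with jumps below \<open>e / 2\<close> becomes a walk to \<open>y\<close> with jumps below \<open>e\<close>
          by redirecting its last jump\<close>
        have "h x = h y" if "d x y < e / 2" for x y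
        proof -
          obtain n where n: "n \<ge> 1" "(c, x) \<in> step f d (e / 2) ^^ n"
            using conn[of "e / 2"] e by auto
          then obtain m w where m: "n = Suc m" "(c, w) \<in> step f d (e / 2) ^^ m"
              "(w, x) \<in> step f d (e / 2)"
            by (cases n) auto
          obtain b where b: "(w, b) \<in> f" "d b x < e / 2" using m(3) by (rule stepE)
          have sub: "step f d (e / 2) \<subseteq> ?S" by (rule step_mono) (use e in simp)
          have "d b y < e" using b(2) that gage_pseudometric(4)[OF d, of b y x] by linarith
          then have "(w, y) \<in> ?S" using b(1) by (rule stepI[rotated])
          moreover have "(c, w) \<in> ?S ^^ m" using m(2) relpow_mono_rel[OF sub] by blast
          ultimately have "(c, y) \<in> ?S ^^ n" unfolding m(1) by (rule relpow_Suc_I[rotated])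
          moreover have "(c, x) \<in> ?S ^^ n" using n(2) relpow_mono_rel[OF sub] by blast
          ultimately show ?thesis using h by simp
        qed
        then show "case p of (x, y) \<Rightarrow> h x = h y" if "case p of (x, y) \<Rightarrow> d x y < e / 2" for p
          using that by auto
      qed
      have suc: "h y = (h x + 1) mod int k" if "(x, y) \<in> f" for x y
      proof -
        obtain n where n: "(c, x) \<in> ?S ^^ n" using conn[OF e] by blast
        then have y: "(c, y) \<in> ?S ^^ Suc n" using that subset_step[OF d e] by (meson relpow_Suc_I subsetD)
        then show ?thesis unfolding h[OF n] h[OF y] by (simp add: zmod_int mod_simps add.commute)
      qed
      then show "maps_rel h f (shift (int k))"
        by (auto simp: maps_rel_def shift_def residue_ring_def)
      \<comment> \<open>Every point has an outgoing edge, so some walk from \<open>c\<close> has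
        length exactly \<open>i\<close>, and its endpoint takes the value \<open>i\<close>.\<close>
      have "\<exists>x. h x = int i" if "i < k" for i
      proof -
        have "\<exists>x. (c, x) \<in> ?S ^^ n" for n
        proof (induction n)
          case (Suc n)
          then obtain x where "(c, x) \<in> ?S ^^ n" by blast
          moreover obtain y where "(x, y) \<in> ?S"
            using \<open>surj_rel f\<close> subset_step[OF d e] unfolding surj_rel_def by blast
          ultimately show ?case by (meson relpow_Suc_I)
        qed auto
        then show ?thesis using h that by (metis mod_less)
      qed
      then have "int i \<in> range h" if "i < k" for i using that by (metis rangeI)
      then have "{0..int k - 1} \<subseteq> range h" by auto (metis nat_0_le nat_less_iff zle_diff1_eq)
      moreover have "range h \<subseteq> {0..int k - 1}" using k by (auto simp: h_def zmod_int)
      ultimately show "range h = carrier (residue_ring (int k))"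
        by (auto simp: residue_ring_def)
    qed
    then show ?thesis using none[of "int k"] k by simp
  qed
qed

section \<open>Inverses and iterates\<close>

text \<open>Reversal puts each jump before its edge instead of after it. Appending an exact edge
  from \<open>a\<close> into \<open>x\<close> to a walk from \<open>y\<close> to \<open>a\<close>
  allows the regrouping, at the cost of one extra step.\<close>

lemma chain_mixing_converse:
  assumes "chain_mixing f"
  shows "chain_mixing (f\<inverse>)"
  unfolding chain_mixing_iff
proof (intro conjI ballI allI impI)
  have surj: "surj_rel f" using assms by (simp add: chain_mixing_iff)
  then show "surj_rel (f\<inverse>)" by (auto simp: surj_rel_def)
  fix d :: "'a \<Rightarrow> 'a \<Rightarrow> real" and e :: real and x y
  assume d: "d \<in> gage" and e: "e > 0"
  let ?E = "{(x, y). d x y < e}"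
  let ?S = "step f d e" and ?T = "step (f\<inverse>) d e"
  have conv: "?T = (?E O f)\<inverse>"
    by (auto simp: step_def converse_relcomp gage_pseudometric(3)[OF d])
  \<comment> \<open>Reassociation turns edge-jump blocks followed by an edge into an edge followed
    by jump-edge blocks; a trivial jump is put before that first edge.\<close>
  have slide: "?S ^^ n O f \<subseteq> (?E O f) ^^ Suc n" for n
  proof (induction n)
    case 0
    show ?case using e by (force simp: gage_pseudometric(2)[OF d])
  next
    case (Suc n)
    have "?S ^^ Suc n O f = (?S ^^ n O f) O (?E O f)" by (simp add: step_def O_assoc)
    also have "\<dots> \<subseteq> (?E O f) ^^ Suc n O (?E O f)" using Suc by (rule relcomp_mono) simp
    finally show ?case by simp
  qed
  obtain a where a: "(a, x) \<in> f" using surj unfolding surj_rel_def by blast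
  obtain N where N: "\<And>n. n \<ge> N \<Longrightarrow> (y, a) \<in> ?S ^^ n"
    using chain_mixingD[OF assms d e] by metis
  have "(x, y) \<in> ?T ^^ n" if n: "n \<ge> Suc N" for n
  proof -
    obtain m where m: "n = Suc m" "m \<ge> N" using n by (cases n) auto
    have "(y, x) \<in> ?S ^^ m O f" using N[OF m(2)] a by (rule relcompI)
    then have "(y, x) \<in> (?E O f) ^^ n" unfolding m(1) by (rule subsetD[OF slide])
    then show ?thesis unfolding conv converse_relpow[symmetric] by (rule converseI)
  qed
  then show "\<exists>N. \<forall>n\<ge>N. (x, y) \<in> ?T ^^ n" by blast
qed

text \<open>The \<open>k\<close>-th power fixes every level of a factor map onto \<int> modulo
  \<open>k\<close>, so its fine chains cannot pass from level 0 to level 1.\<close>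

lemma iterates_transitive_imp_mixing:
  assumes "chain_transitive f" "\<And>k. k \<ge> 1 \<Longrightarrow> chain_transitive (f ^^ k)"
  shows "chain_mixing f"
proof (rule no_cyclic_factor_imp_chain_mixing[OF assms(1)])
  fix k :: int assume k: "k > 1"
  show "\<not> has_cyclic_factor f k"
  proof
    assume "has_cyclic_factor f k"
    then obtain h where h: "uniformly_continuous_discrete h" "maps_rel h f (shift k)"
      and surj: "range h = {0..k - 1}"
      by (auto simp: has_cyclic_factor_def residue_ring_def)
    have pow: "[h y = h x + k] (mod k)" if "(x, y) \<in> f ^^ nat k" for x y
      using relpow_cong_int[of f h 1 k, OF maps_rel_shift_cong[OF h(2)] that] k by simp
    have "0 \<in> range h" "1 \<in> range h" using surj k by auto
    then obtain x y where xy: "h x = 0" "h y = 1" by (metis imageE)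
    let ?d = "\<lambda>x y. if h x = h y then 0 else 1 :: real"
    have "chain_transitive (f ^^ nat k)" using assms(2) k by simp
    then obtain n where "(x, y) \<in> step (f ^^ nat k) ?d 1 ^^ n"
      using chain_transitiveD[OF _ gage_discrete[OF h(1)] zero_less_one] by blast
    then have "[h y = h x + int n * k] (mod k)" using step_discrete_cong[of "f ^^ nat k" h k k x y n] pow by blast
    then show False using xy k by (simp add: Cong.cong_def)
  qed
qed

lemma graph_of_relpow: "graph_of g ^^ n = graph_of (g ^^ n)"
  by (induction n) (auto simp: graph_of_def)

lemma uniformly_continuous_on_funpow:
  fixes g :: "'a::uniform_space \<Rightarrow> 'a"
  assumes "uniformly_continuous_on UNIV g"
  shows "uniformly_continuous_on UNIV (g ^^ n)"
proof (induction n)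
  case 0
  show ?case by (simp add: id_def uniformly_continuous_on_id)
next
  case (Suc n)
  then show ?case
    using filterlim_compose[of "\<lambda>(x, y). (g x, g y)" uniformity uniformity
        "\<lambda>(x, y). ((g ^^ n) x, (g ^^ n) y)" uniformity] assms
    by (simp add: uniformly_continuous_on_uniformity case_prod_beta' comp_def)
qed

text \<open>The sum controls how far a jump can grow under fewer than \<open>k\<close> further
  applications of \<open>g\<close>.\<close>

lemma gage_sum_iterates:
  fixes g :: "'a::uniform_space \<Rightarrow> 'a"
  assumes g: "uniformly_continuous_on UNIV g" and d: "d \<in> gage"
  shows "(\<lambda>x y. \<Sum>i<k. d ((g ^^ i) x) ((g ^^ i) y)) \<in> gage"
proof -
  obtain B where B: "\<And>x y. d x y \<le> B" using gage_bounded[OF d] by blast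
  note gd = gage_pseudometric[OF d]
  show ?thesis
  proof (rule gageI[where B = "of_nat k * B"])
    show "(\<Sum>i<k. d ((g ^^ i) x) ((g ^^ i) y)) \<le> of_nat k * B" for x y
      using sum_bounded_above[of "{..<k}" "\<lambda>i. d ((g ^^ i) x) ((g ^^ i) y)" B] B by simp
    fix e :: real assume "e > 0"
    \<comment> \<open>Dividing by \<open>k + 1\<close> covers \<open>k = 0\<close> and keeps the
      total strictly below \<open>e\<close> although the sum is bounded only weakly.\<close>
    have "\<forall>\<^sub>F p in uniformity. d ((g ^^ i) (fst p)) ((g ^^ i) (snd p)) < e / (of_nat k + 1)" for i
      using uniformly_continuous_onD[OF uniformly_continuous_on_funpow[OF g] gage_eventually[OF d]]
        \<open>e > 0\<close> by (simp add: case_prod_beta')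
    then have "\<forall>\<^sub>F p in uniformity. \<forall>i<k. d ((g ^^ i) (fst p)) ((g ^^ i) (snd p)) < e / (of_nat k + 1)"
      by (simp add: eventually_ball_finite flip: lessThan_iff Ball_def)
    then show "\<forall>\<^sub>F p in uniformity. (\<Sum>i<k. d ((g ^^ i) (fst p)) ((g ^^ i) (snd p))) < e"
    proof eventually_elim
      case (elim p)
      have "(\<Sum>i<k. d ((g ^^ i) (fst p)) ((g ^^ i) (snd p))) \<le> of_nat k * (e / (of_nat k + 1))"
        using sum_bounded_above[of "{..<k}" "\<lambda>i. d ((g ^^ i) (fst p)) ((g ^^ i) (snd p))"
            "e / (of_nat k + 1)"] elim by (auto intro: less_imp_le)
      also have "\<dots> < e" using \<open>e > 0\<close> by (simp add: field_simps)
      finally show ?case .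
    qed
  qed (auto intro!: sum_nonneg sum_mono simp: gd simp flip: sum.distrib)
qed

text \<open>
  Along a chain \<open>z\<^sub>0, \<dots>, z\<^sub>k\<close> of \<open>g\<close> the points \<open>g\<^bsup>k - j\<^esup> z\<^sub>j\<close> interpolate between \<open>g\<^bsup>k\<^esup> z\<^sub>0\<close> and \<open>z\<^sub>k\<close>.
\<close>

lemma relpow_step_graph:
  fixes g :: "'a::uniform_space \<Rightarrow> 'a" and k :: nat
  assumes d: "d \<in> gage" and k: "k \<ge> 1"
  defines "D \<equiv> \<lambda>x y. \<Sum>i<k. d ((g ^^ i) x) ((g ^^ i) y)"
  shows "step (graph_of g) D (e / k) ^^ k \<subseteq> step (graph_of g ^^ k) d e"
proof
  fix p assume p: "p \<in> step (graph_of g) D (e / k) ^^ k"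
  obtain x y where xy: "p = (x, y)" by (cases p)
  obtain z where z: "z 0 = x" "z k = y" "\<And>j. j < k \<Longrightarrow> (z j, z (Suc j)) \<in> step (graph_of g) D (e / k)"
    using p unfolding xy relpow_fun_conv by blast
  \<comment> \<open>Consecutive interpolating points are the images of one jump under the iterate
    with exponent \<open>k - Suc j < k\<close>, whose distance is one summand of
    \<open>D\<close>.\<close>
  have s: "d ((g ^^ (k - j)) (z j)) ((g ^^ (k - Suc j)) (z (Suc j))) < e / k" if "j < k" for j
  proof -
    have "k - j = Suc (k - Suc j)" using that by simp
    then have "d ((g ^^ (k - j)) (z j)) ((g ^^ (k - Suc j)) (z (Suc j))) =
        d ((g ^^ (k - Suc j)) (g (z j))) ((g ^^ (k - Suc j)) (z (Suc j)))"
      by (simp add: funpow_swap1)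
    also have "\<dots> \<le> D (g (z j)) (z (Suc j))" unfolding D_def
      by (rule member_le_sum[where f = "\<lambda>i. d ((g ^^ i) (g (z j))) ((g ^^ i) (z (Suc j)))"])
        (use that gage_pseudometric[OF d] in auto)
    also have "\<dots> < e / k" using z(3)[OF that] by (auto elim!: stepE simp: graph_of_def)
    finally show ?thesis .
  qed
  have "d ((g ^^ k) x) ((g ^^ (k - j)) (z j))
      \<le> (\<Sum>i<j. d ((g ^^ (k - i)) (z i)) ((g ^^ (k - Suc i)) (z (Suc i))))" if "j \<le> k" for j
    using that
  proof (induction j)
    case 0
    then show ?case by (simp add: z gage_pseudometric(2)[OF d])
  next
    case (Suc j)
    then show ?case
      using gage_pseudometric(4)[OF d, of "(g ^^ k) x" "(g ^^ (k - Suc j)) (z (Suc j))" "(g ^^ (k - j)) (z j)"]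
      by simp
  qed
  from this[of k] have "d ((g ^^ k) x) y
      \<le> (\<Sum>i<k. d ((g ^^ (k - i)) (z i)) ((g ^^ (k - Suc i)) (z (Suc i))))"
    using z by simp
  also have "\<dots> < (\<Sum>i<k. e / k)" using k s by (intro sum_strict_mono) (auto simp: lessThan_empty_iff)
  also have "\<dots> = e" using k by simp
  finally have "d ((g ^^ k) x) y < e" .
  then show "p \<in> step (graph_of g ^^ k) d e"
    unfolding xy graph_of_relpow by (intro stepI[of _ "(g ^^ k) x"]) (auto simp: graph_of_def)
qed

lemma surj_rel_relpow:
  assumes "surj_rel f"
  shows "surj_rel (f ^^ n)"
proof -
  have "\<exists>y. (x, y) \<in> f ^^ n" for x n
    using assms by (induction n) (auto simp: surj_rel_def, meson relcomp.relcompI)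
  moreover have "\<exists>y. (y, x) \<in> f ^^ n" for x n
    using assms by (induction n arbitrary: x) (auto simp: surj_rel_def, meson relcomp.relcompI)
  ultimately show ?thesis unfolding surj_rel_def by blast
qed

text \<open>A walk of length \<open>k * n\<close> is cut into \<open>n\<close> blocks of length
  \<open>k\<close>, each of which is one step of the iterate.\<close>

lemma chain_mixing_iterate:
  assumes g: "uniformly_continuous_on UNIV g" and mix: "chain_mixing (graph_of g)" and k: "k \<ge> 1"
  shows "chain_mixing (graph_of g ^^ k)"
  unfolding chain_mixing_iff
proof (intro conjI ballI allI impI)
  show "surj_rel (graph_of g ^^ k)" using mix by (simp add: chain_mixing_iff surj_rel_relpow)
  fix d :: "'a \<Rightarrow> 'a \<Rightarrow> real" and e :: real and x y
  assume d: "d \<in> gage" and e: "e > 0"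
  let ?D = "\<lambda>x y. \<Sum>i<k. d ((g ^^ i) x) ((g ^^ i) y)"
  have pos: "e / k > 0" using e k by simp
  obtain N where N: "\<forall>n\<ge>N. (x, y) \<in> step (graph_of g) ?D (e / k) ^^ n"
    using chain_mixingD[OF mix gage_sum_iterates[OF g d, of k] pos, of x y] by blast
  have "(x, y) \<in> step (graph_of g ^^ k) d e ^^ n" if "n \<ge> N" for n
  proof -
    have "k * n \<ge> N" using that k by (metis le_trans mult_le_mono1 nat_mult_1)
    then have "(x, y) \<in> (step (graph_of g) ?D (e / k) ^^ k) ^^ n"
      using N unfolding relpow_mult[symmetric] by blast
    then show ?thesis using relpow_mono_rel[OF relpow_step_graph[OF d k]] by blast
  qed
  then show "\<exists>N. \<forall>n\<ge>N. (x, y) \<in> step (graph_of g ^^ k) d e ^^ n" by blast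
qed

theorem theorem7p20:
  fixes f :: "('a::uniform_space \<times> 'a) set"
  assumes "chain_transitive f"
  shows
    "((chain_mixing f \<longleftrightarrow> chain_mixing (rel_times f f)) \<and>
      (chain_mixing f \<longleftrightarrow> chain_transitive (rel_times f f)) \<and>
      (chain_mixing f \<longleftrightarrow>
        \<not> (\<exists>k::int. k > 1 \<and> (\<exists>h::'a \<Rightarrow> int. uniformly_continuous_discrete h \<and>
              h ` UNIV = carrier (residue_ring k) \<and> maps_rel h f (shift k)))))
     \<and> (chain_mixing f \<longrightarrow> chain_mixing (f\<inverse>))
     \<and> ((\<forall>k::nat. k \<ge> 1 \<longrightarrow> chain_transitive (f ^^ k)) \<longrightarrow> chain_mixing f)
     \<and> (\<forall>g. f = graph_of g \<and> uniformly_continuous_on UNIV g \<and> chain_mixing f \<longrightarrow>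
          (\<forall>k::nat. k \<ge> 1 \<longrightarrow> chain_mixing (f ^^ k)))"
proof -
  have times: "chain_mixing f \<longleftrightarrow> chain_mixing (rel_times f f)"
    "chain_mixing f \<longleftrightarrow> chain_transitive (rel_times f f)"
    using assms chain_mixing_times chain_mixing_imp_transitive chain_transitive_times_imp_mixing
    by blast+
  have factor: "chain_mixing f \<longleftrightarrow> \<not> (\<exists>k>1. has_cyclic_factor f k)"
    using assms chain_mixing_imp_no_cyclic_factor no_cyclic_factor_imp_chain_mixing by blast
  have inverse: "chain_mixing f \<longrightarrow> chain_mixing (f\<inverse>)"
    using chain_mixing_converse by (rule impI)
  have iterates: "(\<forall>k::nat. k \<ge> 1 \<longrightarrow> chain_transitive (f ^^ k)) \<longrightarrow> chain_mixing f"
    using iterates_transitive_imp_mixing[OF assms] by blast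
  have map: "\<forall>g. f = graph_of g \<and> uniformly_continuous_on UNIV g \<and> chain_mixing f \<longrightarrow>
      (\<forall>k::nat. k \<ge> 1 \<longrightarrow> chain_mixing (f ^^ k))"
    using chain_mixing_iterate by blast
  show ?thesis
    by (intro conjI times factor[unfolded has_cyclic_factor_def] inverse iterates map)
qed

end
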